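(* For every poset $\mathbb P$ and every $p\in\mathbb P$, the principle $\mathsf U_{\mathrm{fin}}(\mathsf V_p,\Gamma_p)$ holds if and only if Player I has no winning strategy in the game $\mathsf G_{\mathrm{fin}}(\mathsf V_p,\Gamma_p)$.
   Context: Let $\mathbb P$ be a poset and $p\in\mathbb P$. Put $\mathsf D_p=\{x\in\mathbb P:x\le p\}$ and let $\mathsf V_p$ be the family of nonempty subsets of $\mathbb P$ whose supremum, computed in $\mathbb P$, is $p$. $\Gamma_p$ denotes the collection of sequences $(F_n)_{n\in\omega}$ of finite subsets of $\mathsf D_p$ such that $\bigcup_{n\in J}F_n\in\mathsf V_p$ for every infinite $J\subseteq\omega$. $\mathsf U_{\mathrm{fin}}(\mathsf V_p,\Gamma_p)$ asserts that every sequence $(A_n)_{n\in\omega}$ in $\mathsf V_p$ admits finite sets $F_n\subseteq A_n$ with $(F_n)_{n\in\omega}\in\Gamma_p$. In the game $\mathsf G_{\mathrm{fin}}(\mathsf V_p,\Gamma_p)$, in each inning $n\in\omega$ Player I chooses $A_n\in\mathsf V_p$ and then Player II chooses a finite subset $F_n\subseteq A_n$; Player II wins if $(F_n)_{n\in\omega}\in\Gamma_p$, otherwise Player I wins. A strategy is a function telling a player how to play based on the previous moves of the opponent. *)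

theory Defs
  imports Main "HOL-Library.Lub_Glb"
begin

definition V :: "'a::order \<Rightarrow> 'a set set" where
  "V p = {A. A \<noteq> {} \<and> isLub UNIV A p}"

definition Gamma :: "'a::order \<Rightarrow> (nat \<Rightarrow> 'a set) set" where
  "Gamma p = {F. (\<forall>n. finite (F n) \<and> F n \<subseteq> {..p}) \<and>
                 (\<forall>J. infinite J \<longrightarrow> (\<Union>n\<in>J. F n) \<in> V p)}"

definition U_fin :: "'a set set \<Rightarrow> (nat \<Rightarrow> 'a set) set \<Rightarrow> bool" where
  "U_fin \<A> \<B> \<longleftrightarrow>
     (\<forall>A. (\<forall>n. A n \<in> \<A>) \<longrightarrow>
          (\<exists>F. (\<forall>n. finite (F n) \<and> F n \<subseteq> A n) \<and> F \<in> \<B>))"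

(* A strategy of Player I maps the list of Player II's previous moves (oldest first)
   to Player I's next move.  A history is legal against it if each of these moves is a
   finite subset of the set that the strategy had played in the same inning. *)
definition legal_history :: "('a set list \<Rightarrow> 'a set) \<Rightarrow> 'a set list \<Rightarrow> bool" where
  "legal_history \<sigma> h \<longleftrightarrow>
     (\<forall>i<length h. finite (h ! i) \<and> h ! i \<subseteq> \<sigma> (take i h))"

definition strategy_I :: "'a set set \<Rightarrow> ('a set list \<Rightarrow> 'a set) \<Rightarrow> bool" where
  "strategy_I \<A> \<sigma> \<longleftrightarrow> (\<forall>h. legal_history \<sigma> h \<longrightarrow> \<sigma> h \<in> \<A>)"

definition winning_strategy_I ::
  "'a set set \<Rightarrow> (nat \<Rightarrow> 'a set) set \<Rightarrow> ('a set list \<Rightarrow> 'a set) \<Rightarrow> bool" where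
  "winning_strategy_I \<A> \<B> \<sigma> \<longleftrightarrow>
     strategy_I \<A> \<sigma> \<and>
     (\<forall>F. (\<forall>n. finite (F n) \<and> F n \<subseteq> \<sigma> (map F [0..<n])) \<longrightarrow> F \<notin> \<B>)"

end

theory Submission
  imports Defs "HOL-Library.Countable"
begin

text \<open>
  A sequence of sets is a strategy of Player I that ignores the moves of Player II, so if Player I
  has no winning strategy then the selection principle holds.

  Conversely, let the selection principle hold and let \<open>\<sigma>\<close> be a strategy of Player I. Applied to a
  constant sequence, the principle shows that every \<open>A \<in> V p\<close> contains an increasing sequence of
  finite sets \<open>E 0 \<subseteq> E 1 \<subseteq> \<dots>\<close> whose union is still in \<open>V p\<close> (\<open>U_fin_exhaustion\<close>). Let Player II
  answer each move of \<open>\<sigma>\<close> only by members of such a sequence, chosen once for every history. The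
  histories that arise are indexed by the finite sequences of natural numbers, so there are only
  countably many of them, and the principle can be applied to all of them at once: it gives a
  finite set \<open>G s\<close> at every node \<open>s\<close> such that the union over any infinite set of nodes is in
  \<open>V p\<close>. At the node \<open>s\<close> the set \<open>G s\<close> lies in some member of the increasing sequence, and Player II
  plays that member. The resulting play follows a branch of the tree, and its nodes are pairwise
  distinct; hence the union of infinitely many moves of Player II contains the union of \<open>G\<close> over
  infinitely many nodes, and Player II wins.
\<close>

lemma V_subset_atMost:
  assumes "A \<in> V p"
  shows "A \<subseteq> {..p}"
  using assms by (auto simp: V_def isLub_def leastP_def isUb_def setle_def)

lemma V_superset:
  assumes "A \<in> V p" "A \<subseteq> B" "B \<subseteq> {..p}"
  shows "B \<in> V p"
  using assms unfolding V_def isLub_def leastP_def isUb_def setle_def setge_def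
  by (simp add: subset_iff) blast

lemma legal_history_Nil: "legal_history \<sigma> []"
  by (simp add: legal_history_def)

lemma legal_history_snoc:
  "legal_history \<sigma> (h @ [B]) \<longleftrightarrow> legal_history \<sigma> h \<and> finite B \<and> B \<subseteq> \<sigma> h"
  by (auto simp: legal_history_def nth_append less_Suc_eq)

lemma U_fin_exhaustion:
  assumes "U_fin (V p) (Gamma p)" "A \<in> V p"
  shows "\<exists>E::nat \<Rightarrow> 'a::order set.
           (\<forall>m. finite (E m) \<and> E m \<subseteq> A) \<and> mono E \<and> (\<Union>m. E m) \<in> V p"
proof -
  obtain F where F: "\<And>n. finite (F n)" "\<And>n. F n \<subseteq> A" "F \<in> Gamma p"
    using assms(1)[unfolded U_fin_def, rule_format, of "\<lambda>_. A"] assms(2) by blast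
  show ?thesis
  proof (intro exI conjI allI)
    show "finite (\<Union>i\<le>m. F i)" "(\<Union>i\<le>m. F i) \<subseteq> A" for m
      using F by auto
    show "mono (\<lambda>m. \<Union>i\<le>m. F i)"
      by (rule monoI) (auto intro: order_trans)
    have "(\<Union>m. \<Union>i\<le>m. F i) = (\<Union>m. F m)"
      by auto
    also have "\<dots> \<in> V p"
      using F(3) by (simp add: Gamma_def)
    finally show "(\<Union>m. \<Union>i\<le>m. F i) \<in> V p" .
  qed
qed

lemma finite_subset_UN_mono:
  fixes E :: "nat \<Rightarrow> 'a set"
  assumes "finite S" "S \<subseteq> (\<Union>m. E m)" "mono E"
  shows "\<exists>m. S \<subseteq> E m"
  using assms(1,2)
proof (induction S)
  case (insert x S)
  then obtain m k where "S \<subseteq> E m" "x \<in> E k"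
    by auto
  then have "insert x S \<subseteq> E (max m k)"
    using monoD[OF assms(3), of m "max m k"] monoD[OF assms(3), of k "max m k"] by auto
  then show ?case ..
qed simp

text \<open>
  The history that arises when Player II answers the history \<open>h\<close> by \<open>E h m\<close>, where the numbers
  \<open>m\<close> are taken from a list with the most recent choice first. Histories themselves list the
  oldest move first.
\<close>

primrec history_of :: "('a set list \<Rightarrow> nat \<Rightarrow> 'a set) \<Rightarrow> nat list \<Rightarrow> 'a set list" where
  "history_of E [] = []"
| "history_of E (m # s) = history_of E s @ [E (history_of E s) m]"

text \<open>The branch along which the choice at every node \<open>s\<close> is \<open>g s\<close>, most recent choice first.\<close>

primrec branch :: "(nat list \<Rightarrow> nat) \<Rightarrow> nat \<Rightarrow> nat list" where
  "branch g 0 = []"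
| "branch g (Suc n) = g (branch g n) # branch g n"

lemma length_branch: "length (branch g n) = n"
  by (induction n) auto

lemma inj_branch: "inj (branch g)"
  by (metis injI length_branch)

lemma history_of_branch:
  "history_of E (branch g n) =
     map (\<lambda>k. E (history_of E (branch g k)) (g (branch g k))) [0..<n]"
  by (induction n) auto

lemma legal_history_of:
  assumes "\<And>h m. legal_history \<sigma> h \<Longrightarrow> finite (E h m) \<and> E h m \<subseteq> \<sigma> h"
  shows "legal_history \<sigma> (history_of E s)"
  using assms by (induction s) (simp_all add: legal_history_Nil legal_history_snoc)

lemma U_fin_defeats_strategy:
  fixes p :: "'a::order"
  assumes U: "U_fin (V p) (Gamma p)" and \<sigma>: "strategy_I (V p) \<sigma>"
  obtains F where "\<And>n. finite (F n)" "\<And>n. F n \<subseteq> \<sigma> (map F [0..<n])" "F \<in> Gamma p"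
proof -
  have "\<forall>h. \<exists>E::nat \<Rightarrow> 'a set. legal_history \<sigma> h \<longrightarrow>
          (\<forall>m. finite (E m) \<and> E m \<subseteq> \<sigma> h) \<and> mono E \<and> (\<Union>m. E m) \<in> V p"
    using U_fin_exhaustion[OF U] \<sigma> by (simp add: strategy_I_def)
  from choice[OF this]
  obtain E :: "'a set list \<Rightarrow> nat \<Rightarrow> 'a set" where
    E: "\<And>h m. legal_history \<sigma> h \<Longrightarrow> finite (E h m) \<and> E h m \<subseteq> \<sigma> h"
       "\<And>h. legal_history \<sigma> h \<Longrightarrow> mono (E h)"
       "\<And>h. legal_history \<sigma> h \<Longrightarrow> (\<Union>m. E h m) \<in> V p"
    by blast
  define H where "H = history_of E"
  have legal: "legal_history \<sigma> (H s)" for s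
    unfolding H_def using E(1) by (rule legal_history_of)
  have "\<forall>n. (\<Union>m. E (H (from_nat n)) m) \<in> V p"
    using E(3) legal by blast
  from U[unfolded U_fin_def, THEN spec, THEN mp, OF this]
  obtain G where G: "\<And>n. finite (G n)" "\<And>n. G n \<subseteq> (\<Union>m. E (H (from_nat n)) m)"
      "G \<in> Gamma p"
    by blast
  have "\<exists>m. G (to_nat s) \<subseteq> E (H s) m" for s :: "nat list"
    using finite_subset_UN_mono[OF G(1) _ E(2)[OF legal]] G(2)[of "to_nat s"] by simp
  then obtain g where g: "\<And>s. G (to_nat s) \<subseteq> E (H s) (g s)"
    by metis
  define F where "F n = E (H (branch g n)) (g (branch g n))" for n
  have hist: "map F [0..<n] = H (branch g n)" for n
    unfolding F_def H_def by (rule history_of_branch[symmetric])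
  show thesis
  proof
    show fin: "finite (F n)" for n
      using E(1)[OF legal] by (simp add: F_def)
    show sub: "F n \<subseteq> \<sigma> (map F [0..<n])" for n
      unfolding hist using E(1)[OF legal] by (simp add: F_def)
    have "\<sigma> (map F [0..<n]) \<in> V p" for n
      unfolding hist using \<sigma> legal by (simp add: strategy_I_def)
    then have below: "F n \<subseteq> {..p}" for n
      using sub V_subset_atMost by blast
    have "(\<Union>n\<in>J. F n) \<in> V p" if "infinite J" for J
    proof (rule V_superset)
      \<comment> \<open>Distinct innings are played at distinct nodes, so infinitely many nodes are visited.\<close>
      have "inj (\<lambda>n. to_nat (branch g n))"
        using inj_branch by (simp add: inj_def)
      then have "infinite ((\<lambda>n. to_nat (branch g n)) ` J)"
        using that finite_imageD inj_on_subset by blast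
      then show "(\<Union>n\<in>(\<lambda>n. to_nat (branch g n)) ` J. G n) \<in> V p"
        using G(3) unfolding Gamma_def by blast
      show "(\<Union>n\<in>(\<lambda>n. to_nat (branch g n)) ` J. G n) \<subseteq> (\<Union>n\<in>J. F n)"
        using g unfolding F_def by blast
      show "(\<Union>n\<in>J. F n) \<subseteq> {..p}"
        using below by blast
    qed
    then show "F \<in> Gamma p"
      using fin below by (simp add: Gamma_def)
  qed
qed

lemma U_fin_if_no_winning_strategy_I:
  assumes "\<nexists>\<sigma>. winning_strategy_I \<A> \<B> \<sigma>"
  shows "U_fin \<A> \<B>"
  unfolding U_fin_def
proof (intro allI impI)
  fix A :: "nat \<Rightarrow> 'a set"
  assume "\<forall>n. A n \<in> \<A>"
  then have "strategy_I \<A> (\<lambda>h. A (length h))"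
    by (simp add: strategy_I_def)
  moreover have "\<not> winning_strategy_I \<A> \<B> (\<lambda>h. A (length h))"
    using assms by blast
  ultimately show "\<exists>F. (\<forall>n. finite (F n) \<and> F n \<subseteq> A n) \<and> F \<in> \<B>"
    by (simp add: winning_strategy_I_def)
qed

theorem theorem5p3:
  fixes p :: "'a::order"
  shows "U_fin (V p) (Gamma p) \<longleftrightarrow> \<not> (\<exists>\<sigma>. winning_strategy_I (V p) (Gamma p) \<sigma>)"
proof
  assume "U_fin (V p) (Gamma p)"
  then show "\<not> (\<exists>\<sigma>. winning_strategy_I (V p) (Gamma p) \<sigma>)"
    unfolding winning_strategy_I_def by (meson U_fin_defeats_strategy)
next
  assume "\<not> (\<exists>\<sigma>. winning_strategy_I (V p) (Gamma p) \<sigma>)"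
  then show "U_fin (V p) (Gamma p)"
    by (rule U_fin_if_no_winning_strategy_I)
qed

end
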